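(* Let $\mathcal{M}$ be a structure in a language $\mathcal{L}$ with universe $M$, let $t\in\mathbb{R}_{\ge2}$ and let $s,u$ be positive integers. Assume that $E(x,y)\subseteq M^{|x|}\times M^{|y|}$ is a definable relation given by an instance of a formula $\theta(x,y;z)\in\mathcal{L}$, such that the formula $\theta'(x;y,z):=\theta(x,y;z)$ has a distal cell decomposition of exponent $t$, and the graph $E(x,y)$ does not contain $K_{s,u}$. Then there is a constant $\alpha=\alpha(\theta,s,u)$ such that for any finite $P\subseteq M^{|x|}$, $Q\subseteq M^{|y|}$ with $|P|=m$, $|Q|=n$, we have $$|E(P,Q)|\le\alpha\left(m^{\frac{(t-1)s}{ts-1}}n^{\frac{t(s-1)}{ts-1}}+m+n\right).$$
   Context: An instance of $\theta(x,y;z)$ is $\theta(x,y;c)$ for some $c\in M^{|z|}$. $E(P,Q)=E\cap(P\times Q)$. A relation $E\subseteq X\times Y$ is viewed as a bipartite graph with parts $X,Y$; it contains $K_{s,u}$ if there are $A\subseteq X$ with $|A|=s$ and $B\subseteq Y$ with $|B|=u$ such that $A\times B\subseteq E$. The notation $\alpha(\theta,s,u)$ means that $\alpha$ depends only on $\theta,s,u$ (for the given structure and $t$). Formulas are $\mathcal{L}$-formulas without parameters. In a partitioned formula $\varphi(x;y)$ the variables are split into finite tuples $x,y$ of lengths $|x|,|y|$. For $b\in M^{|y|}$ put $\varphi(M^{|x|};b)=\{a\in M^{|x|}:\mathcal{M}\models\varphi(a,b)\}$. For $B\subseteq M^{|y|}$, a set $X\subseteq M^{|x|}$ is crossed by $\varphi(x;B)$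 if for some $b\in B$ both $X\cap\varphi(M^{|x|};b)$ and $X\setminus\varphi(M^{|x|};b)$ are nonempty. A distal cell decomposition $\mathcal{T}$ for a formula $\varphi(x;y)$ is given by a finite set $\Psi(x;y_1,\dots,y_k)$ of formulas with $|y_1|=\dots=|y_k|=|y|$ and, for each $\psi\in\Psi$, a formula $\theta_\psi(y;y_1,\dots,y_k)$ such that for each finite nonempty $B\subseteq M^{|y|}$ the following holds. Let $\mathcal{T}(B)$ be the set of all $\Delta=\psi(M^{|x|};b_1,\dots,b_k)$ with $\psi\in\Psi$, $b_1,\dots,b_k\in B$, such that no $b\in B$ satisfies $\theta_\psi(b;b_1,\dots,b_k)$. Then $\bigcup\mathcal{T}(B)=M^{|x|}$ and no element of $\mathcal{T}(B)$ is crossed by $\varphi(x;B)$. $\mathcal{T}$ has exponent $r$ if there is $C$ with $|\mathcal{T}(B)|\le C|B|^r$ for all finite nonempty $B\subseteq M^{|y|}$. This is applied to $\theta'(x;y,z)$ with parameter variables the concatenated tuple $(y,z)$. *)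

theory Defs
  imports Complex_Main "HOL-Library.NList"
begin

section \<open>First-order languages, formulas and structures\<close>

record ('f, 'r) language =
  fun_syms :: "'f set"
  rel_syms :: "'r set"
  fun_arity :: "'f \<Rightarrow> nat"
  rel_arity :: "'r \<Rightarrow> nat"

datatype 'f trm = Var nat | App 'f "'f trm list"

datatype ('f, 'r) fm =
    Equal "'f trm" "'f trm"
  | Atom 'r "'f trm list"
  | Neg "('f, 'r) fm"
  | Conj "('f, 'r) fm" "('f, 'r) fm"
  | Exist nat "('f, 'r) fm"

primrec is_term :: "('f, 'r) language \<Rightarrow> 'f trm \<Rightarrow> bool" where
  "is_term L (Var i) \<longleftrightarrow> True"
| "is_term L (App f ts) \<longleftrightarrow>
     f \<in> fun_syms L \<and> length ts = fun_arity L f \<and> list_all (is_term L) ts"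

primrec is_fm :: "('f, 'r) language \<Rightarrow> ('f, 'r) fm \<Rightarrow> bool" where
  "is_fm L (Equal t t') \<longleftrightarrow> is_term L t \<and> is_term L t'"
| "is_fm L (Atom R ts) \<longleftrightarrow>
     R \<in> rel_syms L \<and> length ts = rel_arity L R \<and> list_all (is_term L) ts"
| "is_fm L (Neg \<phi>) \<longleftrightarrow> is_fm L \<phi>"
| "is_fm L (Conj \<phi> \<psi>) \<longleftrightarrow> is_fm L \<phi> \<and> is_fm L \<psi>"
| "is_fm L (Exist i \<phi>) \<longleftrightarrow> is_fm L \<phi>"

primrec term_vars :: "'f trm \<Rightarrow> nat set" where
  "term_vars (Var i) = {i}"
| "term_vars (App f ts) = \<Union> (set (map term_vars ts))"

primrec free_vars :: "('f, 'r) fm \<Rightarrow> nat set" where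
  "free_vars (Equal t t') = term_vars t \<union> term_vars t'"
| "free_vars (Atom R ts) = \<Union> (set (map term_vars ts))"
| "free_vars (Neg \<phi>) = free_vars \<phi>"
| "free_vars (Conj \<phi> \<psi>) = free_vars \<phi> \<union> free_vars \<psi>"
| "free_vars (Exist i \<phi>) = free_vars \<phi> - {i}"

record ('f, 'r, 'm) fo_structure =
  universe :: "'m set"
  fun_interp :: "'f \<Rightarrow> 'm list \<Rightarrow> 'm"
  rel_interp :: "'r \<Rightarrow> 'm list set"

definition is_structure :: "('f, 'r) language \<Rightarrow> ('f, 'r, 'm) fo_structure \<Rightarrow> bool" where
  "is_structure L M \<longleftrightarrow>
     universe M \<noteq> {} \<and>
     (\<forall>f \<in> fun_syms L. \<forall>as \<in> nlists (fun_arity L f) (universe M).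
        fun_interp M f as \<in> universe M) \<and>
     (\<forall>R \<in> rel_syms L. rel_interp M R \<subseteq> nlists (rel_arity L R) (universe M))"

primrec term_val :: "('f, 'r, 'm) fo_structure \<Rightarrow> (nat \<Rightarrow> 'm) \<Rightarrow> 'f trm \<Rightarrow> 'm" where
  "term_val M e (Var i) = e i"
| "term_val M e (App f ts) = fun_interp M f (map (term_val M e) ts)"

primrec sat :: "('f, 'r, 'm) fo_structure \<Rightarrow> (nat \<Rightarrow> 'm) \<Rightarrow> ('f, 'r) fm \<Rightarrow> bool" where
  "sat M e (Equal t t') \<longleftrightarrow> term_val M e t = term_val M e t'"
| "sat M e (Atom R ts) \<longleftrightarrow> map (term_val M e) ts \<in> rel_interp M R"
| "sat M e (Neg \<phi>) \<longleftrightarrow> \<not> sat M e \<phi>"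
| "sat M e (Conj \<phi> \<psi>) \<longleftrightarrow> sat M e \<phi> \<and> sat M e \<psi>"
| "sat M e (Exist i \<phi>) \<longleftrightarrow> (\<exists>a \<in> universe M. sat M (e(i := a)) \<phi>)"

text \<open>
  A formula in \<open>n\<close> variables is one whose free variables are among \<open>0, \<dots>, n - 1\<close>; up to
  renaming of variables this is no restriction. Tuples of variables are consecutive blocks:
  in a partitioned formula \<open>\<phi>(x; y)\<close> the variables \<open>0, \<dots>, |x| - 1\<close> form \<open>x\<close> and the next \<open>|y|\<close>
  ones form \<open>y\<close>. Splitting an initial block off differently does not change the formula, so
  \<open>\<theta>(x, y; z)\<close> and \<open>\<theta>'(x; y, z)\<close> are the same syntactic object.
\<close>

definition is_fm_in :: "('f, 'r) language \<Rightarrow> nat \<Rightarrow> ('f, 'r) fm \<Rightarrow> bool" where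
  "is_fm_in L n \<phi> \<longleftrightarrow> is_fm L \<phi> \<and> free_vars \<phi> \<subseteq> {..<n}"

text \<open>\<open>M \<Turnstile> \<phi>(a)\<close>, for \<open>\<phi>\<close> a formula in \<open>length a\<close> variables; the unspecified values of
  \<open>nth a\<close> beyond the length of \<open>a\<close> are then irrelevant (see \<open>models_cong\<close>).\<close>

definition models :: "('f, 'r, 'm) fo_structure \<Rightarrow> ('f, 'r) fm \<Rightarrow> 'm list \<Rightarrow> bool" where
  "models M \<phi> a \<longleftrightarrow> sat M (nth a) \<phi>"

lemma term_val_cong:
  "(\<And>i. i \<in> term_vars t \<Longrightarrow> e i = e' i) \<Longrightarrow> term_val M e t = term_val M e' t"
proof (induction t)
  case (Var j)
  then show ?case by simp
next
  case (App f ts)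
  have "term_val M e t = term_val M e' t" if t: "t \<in> set ts" for t
  proof (rule App.IH[OF t])
    fix i assume "i \<in> term_vars t"
    with t show "e i = e' i" by (intro App.prems) auto
  qed
  then have "map (term_val M e) ts = map (term_val M e') ts" by simp
  then show ?case by (simp only: term_val.simps)
qed

lemma sat_cong:
  "(\<And>i. i \<in> free_vars \<phi> \<Longrightarrow> e i = e' i) \<Longrightarrow> sat M e \<phi> \<longleftrightarrow> sat M e' \<phi>"
proof (induction \<phi> arbitrary: e e')
  case (Equal t t')
  have "term_val M e t = term_val M e' t" "term_val M e t' = term_val M e' t'"
    by (rule term_val_cong, rule Equal, simp)+
  then show ?case by (simp only: sat.simps)
next
  case (Atom R ts)
  have "term_val M e t = term_val M e' t" if t: "t \<in> set ts" for t
  proof (rule term_val_cong)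
    fix i assume "i \<in> term_vars t"
    with t show "e i = e' i" by (intro Atom) auto
  qed
  then have "map (term_val M e) ts = map (term_val M e') ts" by simp
  then show ?case by (simp only: sat.simps)
next
  case (Neg \<phi>)
  have "sat M e \<phi> \<longleftrightarrow> sat M e' \<phi>"
    by (rule Neg.IH, rule Neg.prems, simp)
  then show ?case by (simp only: sat.simps)
next
  case (Conj \<phi> \<psi>)
  have "sat M e \<phi> \<longleftrightarrow> sat M e' \<phi>"
    by (rule Conj.IH, rule Conj.prems, simp)
  moreover have "sat M e \<psi> \<longleftrightarrow> sat M e' \<psi>"
    by (rule Conj.IH, rule Conj.prems, simp)
  ultimately show ?case by (simp only: sat.simps)
next
  case (Exist j \<phi>)
  have "sat M (e(j := a)) \<phi> \<longleftrightarrow> sat M (e'(j := a)) \<phi>" for a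
  proof (rule Exist.IH)
    fix i assume "i \<in> free_vars \<phi>"
    then show "(e(j := a)) i = (e'(j := a)) i"
      by (cases "i = j") (simp_all add: Exist.prems)
  qed
  then show ?case by (simp only: sat.simps)
qed

lemma models_cong:
  assumes "is_fm_in L (length a) \<phi>" and e: "\<And>i. i < length a \<Longrightarrow> e i = a ! i"
  shows "models M \<phi> a \<longleftrightarrow> sat M e \<phi>"
  unfolding models_def
proof (rule sat_cong)
  fix i assume "i \<in> free_vars \<phi>"
  with assms(1) have "i < length a" by (auto simp: is_fm_in_def)
  then show "a ! i = e i" by (rule e[symmetric])
qed


section \<open>Distal cell decompositions\<close>

text \<open>\<open>fibre M nx \<phi> b\<close> is \<open>\<phi>(M\<^bsup>nx\<^esup>; b)\<close>.\<close>

definition fibre ::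
  "('f, 'r, 'm) fo_structure \<Rightarrow> nat \<Rightarrow> ('f, 'r) fm \<Rightarrow> 'm list \<Rightarrow> 'm list set" where
  "fibre M nx \<phi> b = {a \<in> nlists nx (universe M). models M \<phi> (a @ b)}"

definition crossed ::
  "('f, 'r, 'm) fo_structure \<Rightarrow> nat \<Rightarrow> ('f, 'r) fm \<Rightarrow> 'm list set \<Rightarrow> 'm list set \<Rightarrow> bool" where
  "crossed M nx \<phi> B X \<longleftrightarrow>
     (\<exists>b \<in> B. X \<inter> fibre M nx \<phi> b \<noteq> {} \<and> X - fibre M nx \<phi> b \<noteq> {})"

text \<open>The cells \<open>\<T>(B)\<close>; the list \<open>bs\<close> is \<open>(b\<^sub>1, \<dots>, b\<^sub>k)\<close> and \<open>\<Theta> \<psi>\<close> is \<open>\<theta>\<^sub>\<psi>\<close>.\<close>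

definition cells ::
  "('f, 'r, 'm) fo_structure \<Rightarrow> nat \<Rightarrow> nat \<Rightarrow> ('f, 'r) fm set \<Rightarrow> (('f, 'r) fm \<Rightarrow> ('f, 'r) fm)
     \<Rightarrow> 'm list set \<Rightarrow> 'm list set set" where
  "cells M nx k \<Psi> \<Theta> B =
     {fibre M nx \<psi> (concat bs) | \<psi> bs.
        \<psi> \<in> \<Psi> \<and> bs \<in> nlists k B \<and> \<not> (\<exists>b \<in> B. models M (\<Theta> \<psi>) (b @ concat bs))}"

definition distal_cell_decomposition ::
  "('f, 'r) language \<Rightarrow> ('f, 'r, 'm) fo_structure \<Rightarrow> nat \<Rightarrow> nat \<Rightarrow> ('f, 'r) fm
     \<Rightarrow> nat \<Rightarrow> ('f, 'r) fm set \<Rightarrow> (('f, 'r) fm \<Rightarrow> ('f, 'r) fm) \<Rightarrow> bool" where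
  "distal_cell_decomposition L M nx ny \<phi> k \<Psi> \<Theta> \<longleftrightarrow>
     finite \<Psi> \<and>
     (\<forall>\<psi> \<in> \<Psi>. is_fm_in L (nx + k * ny) \<psi> \<and> is_fm_in L (ny + k * ny) (\<Theta> \<psi>)) \<and>
     (\<forall>B. finite B \<and> B \<noteq> {} \<and> B \<subseteq> nlists ny (universe M) \<longrightarrow>
        \<Union> (cells M nx k \<Psi> \<Theta> B) = nlists nx (universe M) \<and>
        (\<forall>\<Delta> \<in> cells M nx k \<Psi> \<Theta> B. \<not> crossed M nx \<phi> B \<Delta>))"

definition has_exponent ::
  "('f, 'r, 'm) fo_structure \<Rightarrow> nat \<Rightarrow> nat \<Rightarrow> nat \<Rightarrow> ('f, 'r) fm set
     \<Rightarrow> (('f, 'r) fm \<Rightarrow> ('f, 'r) fm) \<Rightarrow> real \<Rightarrow> bool" where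
  "has_exponent M nx ny k \<Psi> \<Theta> r \<longleftrightarrow>
     (\<exists>C :: real. \<forall>B. finite B \<and> B \<noteq> {} \<and> B \<subseteq> nlists ny (universe M) \<longrightarrow>
        real (card (cells M nx k \<Psi> \<Theta> B)) \<le> C * real (card B) powr r)"

lemma finite_cells:
  assumes "finite \<Psi>" "finite B"
  shows "finite (cells M nx k \<Psi> \<Theta> B)"
proof (rule finite_subset)
  show "cells M nx k \<Psi> \<Theta> B \<subseteq>
      (\<lambda>(\<psi>, bs). fibre M nx \<psi> (concat bs)) ` (\<Psi> \<times> nlists k B)"
  proof
    fix \<Delta> assume "\<Delta> \<in> cells M nx k \<Psi> \<Theta> B"
    then obtain \<psi> bs where "\<psi> \<in> \<Psi>" "bs \<in> nlists k B" "\<Delta> = fibre M nx \<psi> (concat bs)"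
      unfolding cells_def by blast
    then show "\<Delta> \<in> (\<lambda>(\<psi>, bs). fibre M nx \<psi> (concat bs)) ` (\<Psi> \<times> nlists k B)"
      by (intro image_eqI[where x = "(\<psi>, bs)"] SigmaI) (simp_all only: prod.case)
  qed
  have "nlists k B = {xs. set xs \<subseteq> B \<and> length xs = k}"
    unfolding nlists_def by blast
  with assms(2) have "finite (nlists k B)"
    by (simp only: finite_lists_length_eq)
  with assms(1) show "finite ((\<lambda>(\<psi>, bs). fibre M nx \<psi> (concat bs)) ` (\<Psi> \<times> nlists k B))"
    by (intro finite_imageI finite_cartesian_product)
qed

definition has_distal_cell_decomposition_of_exponent ::
  "('f, 'r) language \<Rightarrow> ('f, 'r, 'm) fo_structure \<Rightarrow> nat \<Rightarrow> nat \<Rightarrow> ('f, 'r) fm \<Rightarrow> real \<Rightarrow> bool" where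
  "has_distal_cell_decomposition_of_exponent L M nx ny \<phi> r \<longleftrightarrow>
     (\<exists>k \<Psi> \<Theta>. distal_cell_decomposition L M nx ny \<phi> k \<Psi> \<Theta> \<and>
              has_exponent M nx ny k \<Psi> \<Theta> r)"


section \<open>Definable bipartite graphs\<close>

text \<open>The relation \<open>E(x, y)\<close> given by the instance \<open>\<theta>(x, y; c)\<close>.\<close>

definition instance_rel ::
  "('f, 'r, 'm) fo_structure \<Rightarrow> nat \<Rightarrow> nat \<Rightarrow> ('f, 'r) fm \<Rightarrow> 'm list
     \<Rightarrow> ('m list \<times> 'm list) set" where
  "instance_rel M nx ny \<theta> c =
     {(a, b). a \<in> nlists nx (universe M) \<and> b \<in> nlists ny (universe M) \<and>
              models M \<theta> (a @ b @ c)}"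

definition contains_K :: "'a set \<Rightarrow> 'b set \<Rightarrow> ('a \<times> 'b) set \<Rightarrow> nat \<Rightarrow> nat \<Rightarrow> bool" where
  "contains_K X Y E s u \<longleftrightarrow>
     (\<exists>A B. A \<subseteq> X \<and> finite A \<and> card A = s \<and> B \<subseteq> Y \<and> finite B \<and> card B = u \<and> A \<times> B \<subseteq> E)"

end

theory Submission
  imports Defs "HOL-Library.FuncSet"
begin

text \<open>
  Cover \<open>M\<^sup>x\<close> by the cells of a random sample of \<open>Q\<close> of size about \<open>q\<close>. Clarkson and Shor's
  argument shows that few cells are crossed by many more than \<open>|Q|/q\<close> elements of \<open>Q\<close>, with
  exponential decay in the excess. Pigeonhole, and recursion inside the cell if it is still crossed
  too often, gives a single set containing a fraction of order \<open>q\<^sup>-\<^sup>t\<close> of \<open>P\<close> and crossed by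
  \<open>O(|Q|/q)\<close> elements of \<open>Q\<close>; a full cutting is not needed. In such a set \<open>P'\<close> fewer than \<open>u\<close>
  elements of \<open>Q\<close> are adjacent to all points, and the crossing ones are controlled by
  Kovari--Sos--Turan. For the right \<open>q\<close> some point of \<open>P'\<close> has degree
  \<open>O(n\<^sup>b m\<^sup>a\<^sup>-\<^sup>1 + 1)\<close>, where \<open>m\<^sup>a n\<^sup>b\<close> is the leading term of the bound. Remove it and
  induct on \<open>|P|\<close>.
\<close>

section \<open>Crossing elements and edge counts in graphs without K_{s,u}\<close>

text \<open>Counterpart of \<open>crossed\<close> for an arbitrary graph, as a set because its size
  is what has to be small. An element of \<open>Q\<close> outside it is adjacent to all points of
  \<open>P\<close> or to none.\<close>

definition crossing :: "('a \<times> 'b) set \<Rightarrow> 'b set \<Rightarrow> 'a set \<Rightarrow> 'b set" where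
  "crossing E Q P = {b \<in> Q. (\<exists>a\<in>P. (a, b) \<in> E) \<and> (\<exists>a\<in>P. (a, b) \<notin> E)}"

lemma crossing_subset: "crossing E Q P \<subseteq> Q"
  by (auto simp: crossing_def)

lemma crossing_mono: "P' \<subseteq> P \<Longrightarrow> Q' \<subseteq> Q \<Longrightarrow> crossing E Q' P' \<subseteq> crossing E Q P"
  by (auto simp: crossing_def)

text \<open>By Pascal's rule \<open>d choose s\<close> grows by at least 1 with each step once
  \<open>d \<ge> s\<close>. This linear comparison replaces the convexity argument in the
  Kovari--Sos--Turan count.\<close>

lemma le_add_binomial:
  assumes "s \<ge> 1"
  shows "d \<le> s + (d choose s)"
proof (induction d)
  case (Suc d)
  obtain s' where s': "s = Suc s'" using assms by (cases s) auto
  show ?case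
  proof (cases "d < s")
    case False
    then have "d choose s' \<ge> 1" using zero_less_binomial_iff[of d s'] s' by linarith
    moreover have "Suc d choose s = (d choose s') + (d choose s)" by (simp add: s')
    ultimately show ?thesis using Suc by linarith
  qed simp
qed simp

lemma sum_neighbours_eq_card:
  assumes "finite P" "finite Q"
  shows "card (E \<inter> P \<times> Q) = (\<Sum>b\<in>Q. card {a \<in> P. (a, b) \<in> E})"
    and "card (E \<inter> P \<times> Q) = (\<Sum>a\<in>P. card {b \<in> Q. (a, b) \<in> E})"
proof -
  have "E \<inter> P \<times> Q = prod.swap ` (SIGMA b:Q. {a \<in> P. (a, b) \<in> E})" by auto
  then show "card (E \<inter> P \<times> Q) = (\<Sum>b\<in>Q. card {a \<in> P. (a, b) \<in> E})"
    using assms by (simp add: card_image card_SigmaI)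
  have "E \<inter> P \<times> Q = (SIGMA a:P. {b \<in> Q. (a, b) \<in> E})" by auto
  then show "card (E \<inter> P \<times> Q) = (\<Sum>a\<in>P. card {b \<in> Q. (a, b) \<in> E})"
    using assms by (simp add: card_SigmaI)
qed

lemma common_neighbours_less:
  assumes "\<not> contains_K X Y E s u" "A \<subseteq> X" "finite A" "card A = s" "finite Q" "Q \<subseteq> Y"
  shows "card {b \<in> Q. A \<times> {b} \<subseteq> E} < u"
proof (rule ccontr)
  assume "\<not> ?thesis"
  then obtain B where "B \<subseteq> {b \<in> Q. A \<times> {b} \<subseteq> E}" "card B = u" "finite B"
    by (meson not_less obtain_subset_with_card_n)
  then have "contains_K X Y E s u"
    using assms unfolding contains_K_def
    by (intro exI[of _ A] exI[of _ B]) auto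
  with assms(1) show False by simp
qed

text \<open>Double counting of pairs of an \<open>s\<close>-subset of \<open>P\<close> and a common
  neighbour of it in \<open>Q\<close>. The bound is cruder than the usual one, but enough once
  \<open>card Q\<close> and \<open>card P ^ s\<close> are separately under control.\<close>

lemma Kovari_Sos_Turan_linear:
  assumes K: "\<not> contains_K X Y E s u" and "s \<ge> 1"
    and P: "finite P" "P \<subseteq> X" and Q: "finite Q" "Q \<subseteq> Y"
  shows "card (E \<inter> P \<times> Q) \<le> s * card Q + u * card P ^ s"
proof -
  define N where "N b = {a \<in> P. (a, b) \<in> E}" for b
  define \<A> where "\<A> = {A. A \<subseteq> P \<and> card A = s}"
  have finN: "finite (N b)" for b using P by (simp add: N_def)
  have fin\<A>: "finite \<A>" using P by (auto simp: \<A>_def)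
  have "card (E \<inter> P \<times> Q) = (\<Sum>b\<in>Q. card (N b))"
    using sum_neighbours_eq_card(1)[OF P(1) Q(1)] by (simp add: N_def)
  also have "\<dots> \<le> (\<Sum>b\<in>Q. s + (card (N b) choose s))"
    by (intro sum_mono le_add_binomial assms)
  also have "\<dots> = s * card Q + (\<Sum>b\<in>Q. card {A \<in> \<A>. A \<subseteq> N b})"
  proof -
    have "{A \<in> \<A>. A \<subseteq> N b} = {A. A \<subseteq> N b \<and> card A = s}" for b
      by (auto simp: \<A>_def N_def)
    then show ?thesis using n_subsets[OF finN] by (simp add: sum.distrib)
  qed
  also have "(\<Sum>b\<in>Q. card {A \<in> \<A>. A \<subseteq> N b}) = (\<Sum>A\<in>\<A>. card {b \<in> Q. A \<subseteq> N b})"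
    using sum_neighbours_eq_card[OF fin\<A> Q(1), of "{(A, b). A \<subseteq> N b}"] by simp
  also have "\<dots> \<le> (\<Sum>A\<in>\<A>. u)"
  proof (rule sum_mono)
    fix A assume "A \<in> \<A>"
    then have A: "A \<subseteq> P" "card A = s" by (auto simp: \<A>_def)
    have "{b \<in> Q. A \<subseteq> N b} = {b \<in> Q. A \<times> {b} \<subseteq> E}"
      using A by (auto simp: N_def)
    then show "card {b \<in> Q. A \<subseteq> N b} \<le> u"
      using common_neighbours_less[OF K _ _ A(2) Q, of] A P
      by (metis finite_subset less_imp_le subset_trans)
  qed
  also have "\<dots> = u * (card P choose s)"
    using n_subsets[OF P(1), of s] by (simp add: \<A>_def)
  also have "\<dots> \<le> u * card P ^ s"
    using assms binomial_le_pow[of s "card P"]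
    by (cases "s \<le> card P") (auto simp: binomial_eq_0)
  finally show ?thesis by simp
qed

section \<open>Elementary estimates for exponentials and real powers\<close>

text \<open>With \<open>y = a * x\<close> the chain is \<open>(1 - x) powr a \<le> exp (- y) \<le> 1
  / (1 + y) \<le> 1 - y / 2\<close>, the last step by \<open>y \<le> 1\<close>. For
  \<open>x = 1 / m\<close> it measures how much \<open>m powr a\<close> drops when one point is
  removed.\<close>

lemma one_minus_powr_le:
  fixes a x :: real
  assumes "0 \<le> x" "x \<le> 1" "0 \<le> a" "a \<le> 1"
  shows "(1 - x) powr a \<le> 1 - a * x / 2"
proof (cases "x = 1")
  case False
  then have x: "x < 1" using assms by simp
  have ax: "0 \<le> a * x" "a * x \<le> 1" using assms mult_le_one by auto
  have "(1 - x) powr a = exp (a * ln (1 - x))" using x by (simp add: powr_def)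
  also have "\<dots> \<le> exp (- (a * x))"
    using ln_le_minus_one[of "1 - x"] x assms mult_left_mono[of "ln (1-x)" "-x" a] by simp
  also have "\<dots> \<le> 1 / (1 + a * x)"
    using ax exp_ge_add_one_self[of "a*x"] by (simp add: exp_minus divide_simps)
  also have "\<dots> \<le> 1 - a * x / 2"
    using ax mult_left_le[of "a*x" "a*x"] by (simp add: divide_simps) (simp add: algebra_simps)
  finally show ?thesis .
qed (use assms in auto)

text \<open>Supplies the threshold past which the exponential weight of a cell outweighs the
  polynomial cost of refining it. Rounding uses \<open>\<lceil>x\<rceil> \<le> 2 * x\<close> and
  \<open>t \<le> k\<close>, whence the factor \<open>2 ^ k\<close>.\<close>

lemma exists_exp_dominates:
  fixes c t :: real
  assumes "t \<ge> 0" "c > 0"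
  shows "\<exists>K\<ge>1. \<forall>x>K. c * \<lceil>x\<rceil> powr t < exp x"
proof -
  define k where "k = nat \<lceil>t\<rceil>"
  have "eventually (\<lambda>x::real. x ^ k / exp x < 1 / (c * 2 ^ k)) at_top"
    using assms by (intro order_tendstoD(2)[OF tendsto_power_div_exp_0]) auto
  then obtain K where K: "\<And>x. x \<ge> K \<Longrightarrow> x ^ k / exp x < 1 / (c * 2 ^ k)"
    by (auto simp: eventually_at_top_linorder)
  have "c * \<lceil>x\<rceil> powr t < exp x" if "x > max K 1" for x
  proof -
    have "c * \<lceil>x\<rceil> powr t \<le> c * (x + 1) powr t"
      using that assms by (intro mult_left_mono powr_mono2) auto
    also have "\<dots> \<le> c * (2 * x) powr k"
      using that assms by (intro mult_left_mono powr_mono_both) (auto simp: k_def of_nat_ceiling)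
    also have "\<dots> = c * 2 ^ k * x ^ k"
      using that by (simp add: powr_realpow power_mult_distrib)
    also have "\<dots> < exp x"
      using K[of x] that assms by (simp add: field_simps)
    finally show ?thesis .
  qed
  then show ?thesis by (intro exI[of _ "max K 1"]) auto
qed

text \<open>The ratio \<open>((n - x) / n) ^ q\<close> is the probability that \<open>q\<close>
  independent draws from \<open>n\<close> elements all miss \<open>x\<close> given ones; by
  \<open>1 - y \<le> exp (- y)\<close> it is at most the inverse of the weight.\<close>

lemma exp_mult_diff_power_le:
  fixes n x :: real
  assumes "0 \<le> x" "x \<le> n" "n > 0"
  shows "exp (q * x / n) * (n - x) ^ q \<le> n ^ q"
proof -
  have "n - x \<le> n * exp (- (x / n))"
    using exp_ge_add_one_self[of "- (x/n)"] mult_left_mono[of "1 - x/n" "exp (-(x/n))" n] assms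
    by (simp add: algebra_simps)
  then have "(n - x) ^ q \<le> (n * exp (- (x / n))) ^ q"
    using assms by (intro power_mono) auto
  also have "\<dots> = n ^ q * exp (- (q * x / n))"
    by (simp add: power_mult_distrib flip: exp_of_nat_mult)
  finally show ?thesis
    by (simp add: exp_minus field_simps)
qed

section \<open>Local cell covers and random sampling\<close>

text \<open>The factor \<open>k + 2\<close> counts the choices of an omitted block, and
  \<open>(k + 1) powr t\<close> comes from the \<open>k + 1\<close> blocks left. It stands outside
  the locale so that the final constant can be chosen before a cover is fixed.\<close>

definition cell_const :: "nat \<Rightarrow> real \<Rightarrow> real \<Rightarrow> real" where
  "cell_const k C t = (k + 2) * C * (k + 1) powr t"

text \<open>
  Abstracts a distal cell decomposition. Assumption \<open>local\<close> is what remains of the formulas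
  \<open>\<theta>\<^sub>\<psi>\<close>: a cell of \<open>B\<close> is still a cell of each subset of \<open>B\<close> that contains its parameters.
\<close>

locale local_cell_cover =
  fixes X :: "'a set" and Y :: "'b set" and E :: "('a \<times> 'b) set"
    and T :: "'b set \<Rightarrow> 'a set set" and k :: nat and C t :: real
  assumes C_ge_1: "C \<ge> 1" and t_ge_2: "t \<ge> 2"
    and finite_T: "finite B \<Longrightarrow> finite (T B)"
    and cover: "finite B \<Longrightarrow> B \<noteq> {} \<Longrightarrow> B \<subseteq> Y \<Longrightarrow> X \<subseteq> \<Union> (T B)"
    and uncrossed: "finite B \<Longrightarrow> B \<noteq> {} \<Longrightarrow> B \<subseteq> Y \<Longrightarrow> \<Delta> \<in> T B \<Longrightarrow> crossing E B \<Delta> = {}"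
    and card_T: "finite B \<Longrightarrow> B \<noteq> {} \<Longrightarrow> B \<subseteq> Y \<Longrightarrow> card (T B) \<le> C * card B powr t"
    and local: "finite B \<Longrightarrow> \<Delta> \<in> T B \<Longrightarrow>
      \<exists>D\<subseteq>B. card D \<le> k \<and> (\<forall>B'. D \<subseteq> B' \<and> B' \<subseteq> B \<longrightarrow> \<Delta> \<in> T B')"
begin

abbreviation C1 :: real where
  "C1 \<equiv> cell_const k C t"

lemma C1_ge_1: "C1 \<ge> 1"
proof -
  have "1 * 1 * 1 \<le> (real k + 2) * C * (real k + 1) powr t"
    using C_ge_1 t_ge_2 by (intro mult_mono) (auto simp: ge_one_powr_ge_zero)
  then show ?thesis by (simp add: cell_const_def add_ac)
qed

text \<open>
  The sample consists of \<open>k + 2\<close> independent blocks \<open>\<sigma> 0, \<dots>, \<sigma> (k + 1)\<close>, each of \<open>q\<close>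
  independent elements. The at most \<open>k\<close> parameters of a cell \<open>\<Delta>\<close> miss some block \<open>l\<close>, so \<open>\<Delta>\<close> is
  already a cell of the other blocks, while block \<open>l\<close>, independent of these, avoids all elements
  crossing \<open>\<Delta>\<close>. The probability of the latter cancels the exponential weight.
\<close>

lemma exists_sample:
  assumes Q: "finite Q" "Q \<noteq> {}" "Q \<subseteq> Y" and q: "q \<ge> (1::nat)"
  shows "\<exists>S\<subseteq>Q. S \<noteq> {} \<and>
    (\<Sum>\<Delta>\<in>T S. exp (q * card (crossing E Q \<Delta>) / card Q)) \<le> C1 * q powr t"
proof -
  define n where "n = card Q"
  have n: "n > 0" using Q by (simp add: n_def card_gt_0_iff)
  \<comment> \<open>Probabilities are counts: each block is a word of length \<open>q\<close> over
    \<open>Q\<close>, repetitions allowed, and all elements of \<open>\<Omega> I\<close> are equally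
    likely.\<close>
  define W where "W = {xs. set xs \<subseteq> Q \<and> length xs = q}"
  have finW: "finite W" and cardW: "card W = n ^ q"
    using Q by (simp_all add: W_def n_def finite_lists_length_eq card_lists_length_eq)
  define U where "U J \<sigma> = (\<Union>l\<in>J. set (\<sigma> l))" for J and \<sigma> :: "nat \<Rightarrow> 'b list"
  \<comment> \<open>There are \<open>k + 2\<close> indices. Pigeonhole needs \<open>k + 1\<close>;
    the extra one keeps the sample nonempty after a block is dropped, also for
    \<open>k = 0\<close>.\<close>
  define I where "I = {..k + 1}"
  define \<Omega> where "\<Omega> J = PiE J (\<lambda>_. W)" for J :: "nat set"
  define g where "g \<Delta> = exp (q * card (crossing E Q \<Delta>) / n)" for \<Delta>
  have g0: "g \<Delta> \<ge> 0" for \<Delta> by (simp add: g_def)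
  define bound where "bound = C1 * q powr t"
  have fin\<Omega>: "finite (\<Omega> J)" if "finite J" for J
    using that finW by (simp add: \<Omega>_def finite_PiE)
  have card\<Omega>: "card (\<Omega> J) = (n ^ q) ^ card J" if "finite J" for J
    using that by (simp add: \<Omega>_def card_PiE cardW)
  have U_Q: "U J \<sigma> \<subseteq> Q" if "\<sigma> \<in> \<Omega> J" for J \<sigma>
    using that unfolding U_def \<Omega>_def W_def by (fastforce dest: PiE_mem)
  have U_ne: "U J \<sigma> \<noteq> {}" if \<sigma>: "\<sigma> \<in> \<Omega> J" and J: "J \<noteq> {}" for J \<sigma>
  proof -
    obtain l where l: "l \<in> J" using J by blast
    then have "\<sigma> l \<in> W" using \<sigma> by (auto simp: \<Omega>_def)
    then have "set (\<sigma> l) \<noteq> {}" using q by (auto simp: W_def)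
    then show ?thesis using l by (auto simp: U_def)
  qed
  have card_U: "card (U J \<sigma>) \<le> card J * q" if "\<sigma> \<in> \<Omega> J" "finite J" for J \<sigma>
  proof -
    have "card (U J \<sigma>) \<le> (\<Sum>l\<in>J. card (set (\<sigma> l)))"
      unfolding U_def using that by (intro card_UN_le) auto
    also have "\<dots> \<le> (\<Sum>l\<in>J. q)"
    proof (rule sum_mono)
      fix l assume "l \<in> J"
      then have "\<sigma> l \<in> W" using that by (auto simp: \<Omega>_def)
      then show "card (set (\<sigma> l)) \<le> q" using card_length[of "\<sigma> l"] by (simp add: W_def)
    qed
    finally show ?thesis by simp
  qed
  have finU: "finite (U J \<sigma>)" if "\<sigma> \<in> \<Omega> J" for J \<sigma>
    using U_Q[OF that] Q finite_subset by blast

  have omit: "\<exists>l\<in>I. \<Delta> \<in> T (U (I - {l}) \<sigma>) \<and> set (\<sigma> l) \<inter> crossing E Q \<Delta> = {}"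
    if \<sigma>: "\<sigma> \<in> \<Omega> I" and \<Delta>: "\<Delta> \<in> T (U I \<sigma>)" for \<sigma> \<Delta>
  proof -
    obtain D where D: "D \<subseteq> U I \<sigma>" "card D \<le> k"
      "\<And>B'. D \<subseteq> B' \<Longrightarrow> B' \<subseteq> U I \<sigma> \<Longrightarrow> \<Delta> \<in> T B'"
      using local[OF finU[OF \<sigma>] \<Delta>] by metis
    have "\<forall>d\<in>D. \<exists>l\<in>I. d \<in> set (\<sigma> l)" using D(1) by (auto simp: U_def)
    then obtain h where h: "\<And>d. d \<in> D \<Longrightarrow> h d \<in> I \<and> d \<in> set (\<sigma> (h d))" by metis
    have finD: "finite D" using D(1) finU[OF \<sigma>] finite_subset by blast
    have "card (h ` D) < card I"
      using card_image_le[OF finD, of h] D(2) by (simp add: I_def)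
    then obtain l where l: "l \<in> I" "l \<notin> h ` D"
      by (metis card_mono finD finite_imageI not_less subsetI)
    have "D \<subseteq> U (I - {l}) \<sigma>"
      using h l by (fastforce simp: U_def)
    moreover have "U (I - {l}) \<sigma> \<subseteq> U I \<sigma>" by (auto simp: U_def)
    ultimately have "\<Delta> \<in> T (U (I - {l}) \<sigma>)" using D(3) by blast
    moreover have "crossing E (U I \<sigma>) \<Delta> = {}"
      using uncrossed[OF finU[OF \<sigma>] U_ne[OF \<sigma>] _ \<Delta>] U_Q[OF \<sigma>] Q by (auto simp: I_def)
    then have "set (\<sigma> l) \<inter> crossing E Q \<Delta> = {}"
      using l(1) by (auto simp: crossing_def U_def)
    ultimately show ?thesis using l(1) by blast
  qed

  have avoid: "g \<Delta> * card {w \<in> W. set w \<inter> crossing E Q \<Delta> = {}} \<le> n ^ q" for \<Delta>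
  proof -
    let ?c = "card (crossing E Q \<Delta>)"
    have c: "?c \<le> n" using Q crossing_subset[of E Q \<Delta>] by (simp add: n_def card_mono)
    have "{w \<in> W. set w \<inter> crossing E Q \<Delta> = {}} =
        {w. set w \<subseteq> Q - crossing E Q \<Delta> \<and> length w = q}"
      by (auto simp: W_def)
    then have "card {w \<in> W. set w \<inter> crossing E Q \<Delta> = {}} = (n - ?c) ^ q"
      using Q crossing_subset[of E Q \<Delta>]
      by (simp add: card_lists_length_eq card_Diff_subset n_def finite_subset)
    then show ?thesis
      using exp_mult_diff_power_le[of ?c n q] c n by (simp add: g_def of_nat_diff)
  qed

  have split: "(\<Sum>\<sigma>\<in>\<Omega> I. \<Sum>\<Delta>\<in>{\<Delta> \<in> T (U (I - {l}) \<sigma>). set (\<sigma> l) \<inter> crossing E Q \<Delta> = {}}. g \<Delta>)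
      \<le> (n ^ q) ^ (k + 2) * (C * ((k + 1) * q) powr t)" (is "?lhs \<le> _") if l: "l \<in> I" for l
  proof -
    let ?J = "I - {l}"
    have J: "finite ?J" "card ?J = k + 1" "?J \<noteq> {}" "insert l ?J = I" "l \<notin> ?J"
      using l by (auto simp: I_def card_Diff_singleton)
    \<comment> \<open>Fubini: a tuple over \<open>I\<close> is a word for block \<open>l\<close> and
      a tuple over the other blocks, and the sample defining the cells depends on the latter
      only.\<close>
    have I_eq: "\<Omega> I = (\<lambda>(w, \<tau>). \<tau>(l := w)) ` (W \<times> \<Omega> ?J)"
      using PiE_insert_eq[of l ?J "\<lambda>_. W"] J(4) by (simp add: \<Omega>_def)
    have inj: "inj_on (\<lambda>(w, \<tau>). \<tau>(l := w)) (W \<times> \<Omega> ?J)"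
      using inj_combinator[OF J(5), of "\<lambda>_. W"] by (simp add: \<Omega>_def)
    have U_upd: "U ?J (\<tau>(l := w)) = U ?J \<tau>" for \<tau> w by (simp add: U_def)
    have "?lhs = (\<Sum>w\<in>W. \<Sum>\<tau>\<in>\<Omega> ?J. \<Sum>\<Delta>\<in>{\<Delta> \<in> T (U ?J \<tau>). set w \<inter> crossing E Q \<Delta> = {}}. g \<Delta>)"
      unfolding I_eq sum.reindex[OF inj] by (simp add: U_upd sum.cartesian_product case_prod_unfold)
    also have "\<dots> = (\<Sum>\<tau>\<in>\<Omega> ?J. \<Sum>w\<in>W. \<Sum>\<Delta>\<in>T (U ?J \<tau>). if set w \<inter> crossing E Q \<Delta> = {} then g \<Delta> else 0)"
      by (subst sum.swap) (intro sum.cong refl sum.inter_filter finite_T finU)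
    also have "\<dots> = (\<Sum>\<tau>\<in>\<Omega> ?J. \<Sum>\<Delta>\<in>T (U ?J \<tau>). g \<Delta> * card {w \<in> W. set w \<inter> crossing E Q \<Delta> = {}})"
      by (intro sum.cong refl, subst sum.swap)
        (simp add: finW mult.commute flip: sum.inter_filter)
    also have "\<dots> \<le> (\<Sum>\<tau>\<in>\<Omega> ?J. \<Sum>\<Delta>\<in>T (U ?J \<tau>). n ^ q)"
      by (simp only: of_nat_sum, intro sum_mono avoid)
    also have "\<dots> \<le> (\<Sum>\<tau>\<in>\<Omega> ?J. n ^ q * (C * ((k + 1) * q) powr t))"
    proof (simp only: of_nat_sum, intro sum_mono)
      fix \<tau> assume \<tau>: "\<tau> \<in> \<Omega> ?J"
      have "card (T (U ?J \<tau>)) \<le> C * card (U ?J \<tau>) powr t"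
        using card_T[OF finU[OF \<tau>] U_ne[OF \<tau> J(3)]] U_Q[OF \<tau>] Q by blast
      also have "\<dots> \<le> C * ((k + 1) * q) powr t"
        using C_ge_1 t_ge_2 card_U[OF \<tau> J(1)] J(2)
        by (intro mult_left_mono powr_mono2) (auto simp flip: of_nat_mult of_nat_add)
      finally show "(\<Sum>\<Delta>\<in>T (U ?J \<tau>). real (n ^ q)) \<le> real (n ^ q) * (C * real ((k + 1) * q) powr t)"
        by (simp add: mult.commute mult_left_mono)
    qed
    also have "\<dots> = (n ^ q) ^ (k + 2) * (C * ((k + 1) * q) powr t)"
      using card\<Omega>[OF J(1)] J(2) by simp
    finally show ?thesis .
  qed

  \<comment> \<open>Union bound over the omitted block provided by \<open>omit\<close>.\<close>
  have "(\<Sum>\<sigma>\<in>\<Omega> I. \<Sum>\<Delta>\<in>T (U I \<sigma>). g \<Delta>) \<le>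
     (\<Sum>\<sigma>\<in>\<Omega> I. \<Sum>l\<in>I. \<Sum>\<Delta>\<in>{\<Delta> \<in> T (U (I - {l}) \<sigma>). set (\<sigma> l) \<inter> crossing E Q \<Delta> = {}}. g \<Delta>)"
  proof (rule sum_mono)
    fix \<sigma> assume \<sigma>: "\<sigma> \<in> \<Omega> I"
    let ?A = "\<lambda>l. {\<Delta> \<in> T (U (I - {l}) \<sigma>). set (\<sigma> l) \<inter> crossing E Q \<Delta> = {}}"
    have fin: "finite (?A l)" if "l \<in> I" for l
    proof -
      have "finite (U (I - {l}) \<sigma>)" by (simp add: U_def I_def)
      then show ?thesis using finite_T by simp
    qed
    have finI: "finite I" by (simp add: I_def)
    have "(\<Sum>\<Delta>\<in>T (U I \<sigma>). g \<Delta>) \<le> (\<Sum>\<Delta>\<in>(\<Union>l\<in>I. ?A l). g \<Delta>)"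
      using omit[OF \<sigma>] fin finI by (intro sum_mono2 g0) auto
    also have "\<dots> \<le> (\<Sum>l\<in>I. \<Sum>\<Delta>\<in>?A l. g \<Delta>)"
    proof -
      have "(\<Sum>\<Delta>\<in>(\<Union>l\<in>I. ?A l). g \<Delta>) = (\<Sum>\<Delta>\<in>snd ` (SIGMA l:I. ?A l). g \<Delta>)"
        by (simp only: snd_image_Sigma)
      also have "\<dots> \<le> (\<Sum>p\<in>(SIGMA l:I. ?A l). g (snd p))"
        using fin finI g0 sum_image_le[of "SIGMA l:I. ?A l" g snd] by (simp add: o_def)
      also have "\<dots> = (\<Sum>l\<in>I. \<Sum>\<Delta>\<in>?A l. g \<Delta>)"
        using fin finI by (subst sum.Sigma) (auto simp: case_prod_unfold)
      finally show ?thesis .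
    qed
    finally show "(\<Sum>\<Delta>\<in>T (U I \<sigma>). g \<Delta>) \<le> (\<Sum>l\<in>I. \<Sum>\<Delta>\<in>?A l. g \<Delta>)" .
  qed
  also have "\<dots> \<le> (\<Sum>l\<in>I. (n ^ q) ^ (k + 2) * (C * ((k + 1) * q) powr t))"
    by (subst sum.swap) (intro sum_mono split)
  also have "\<dots> = card (\<Omega> I) * bound"
  proof -
    have "finite I" "card I = k + 2" by (simp_all add: I_def)
    moreover have "real ((k + 1) * q) powr t = (real k + 1) powr t * q powr t"
      by (simp only: of_nat_mult of_nat_add of_nat_1 powr_mult)
    ultimately show ?thesis
      by (simp only: card\<Omega> bound_def cell_const_def) (simp add: add.commute)
  qed
  finally have total: "(\<Sum>\<sigma>\<in>\<Omega> I. \<Sum>\<Delta>\<in>T (U I \<sigma>). g \<Delta>) \<le> card (\<Omega> I) * bound" .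
  \<comment> \<open>Some tuple does no worse than the average.\<close>
  have "\<Omega> I \<noteq> {}" using card\<Omega>[of I] n by (auto simp: I_def)
  then have "\<exists>\<sigma>\<in>\<Omega> I. (\<Sum>\<Delta>\<in>T (U I \<sigma>). g \<Delta>) \<le> bound"
    using total sum_strict_mono[of "\<Omega> I" "\<lambda>_. bound" "\<lambda>\<sigma>. \<Sum>\<Delta>\<in>T (U I \<sigma>). g \<Delta>"] fin\<Omega>[of I]
    by (force simp: I_def not_le)
  then obtain \<sigma> where \<sigma>: "\<sigma> \<in> \<Omega> I" "(\<Sum>\<Delta>\<in>T (U I \<sigma>). g \<Delta>) \<le> bound" by blast
  show ?thesis
    using U_Q[OF \<sigma>(1)] U_ne[OF \<sigma>(1)] \<sigma>(2)
    by (intro exI[of _ "U I \<sigma>"]) (auto simp: I_def g_def bound_def n_def)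
qed

section \<open>Large cells crossed by few elements\<close>

text \<open>The cells of the sample cover \<open>P\<close> and their weights sum to at most
  \<open>C1 * q powr t\<close>, so some cell has a share of \<open>P\<close> at least proportional
  to its weight. Intersecting it with \<open>P\<close> only removes crossings. As the left side is
  positive, \<open>P'\<close> is nonempty.\<close>

lemma exists_weighted_cell:
  assumes P: "finite P" "P \<noteq> {}" "P \<subseteq> X"
    and Q: "finite Q" "Q \<noteq> {}" "Q \<subseteq> Y" and q: "q \<ge> (1::nat)"
  shows "\<exists>P'\<subseteq>P. card P * exp (q * card (crossing E Q P') / card Q) \<le> C1 * q powr t * card P'"
proof -
  obtain S where S: "S \<subseteq> Q" "S \<noteq> {}"
    and le: "(\<Sum>\<Delta>\<in>T S. exp (q * card (crossing E Q \<Delta>) / card Q)) \<le> C1 * q powr t"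
    using exists_sample[OF Q q] by blast
  define g where "g \<Delta> = exp (q * card (crossing E Q \<Delta>) / card Q)" for \<Delta>
  have finS: "finite S" using S Q finite_subset by blast
  have cov: "P \<subseteq> (\<Union>\<Delta>\<in>T S. P \<inter> \<Delta>)" using cover[OF finS] S P Q by blast
  then have T_ne: "T S \<noteq> {}" using P by auto
  have "\<exists>\<Delta>\<in>T S. card P * g \<Delta> \<le> C1 * q powr t * card (P \<inter> \<Delta>)"
  proof (rule ccontr)
    assume "\<not> ?thesis"
    then have "(\<Sum>\<Delta>\<in>T S. C1 * q powr t * card (P \<inter> \<Delta>)) < (\<Sum>\<Delta>\<in>T S. card P * g \<Delta>)"
      using T_ne finite_T[OF finS] by (intro sum_strict_mono) (auto simp: not_le)
    also have "\<dots> \<le> card P * (C1 * q powr t)"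
      unfolding sum_distrib_left[symmetric] using le by (intro mult_left_mono) (auto simp: g_def)
    finally have "C1 * q powr t * (\<Sum>\<Delta>\<in>T S. card (P \<inter> \<Delta>)) < C1 * q powr t * card P"
      by (simp add: sum_distrib_left mult.commute)
    moreover have "card P \<le> (\<Sum>\<Delta>\<in>T S. card (P \<inter> \<Delta>))"
    proof -
      have "card P \<le> card (\<Union>\<Delta>\<in>T S. P \<inter> \<Delta>)"
        using P finite_T[OF finS] cov by (intro card_mono) auto
      also have "\<dots> \<le> (\<Sum>\<Delta>\<in>T S. card (P \<inter> \<Delta>))"
        by (intro card_UN_le finite_T finS)
      finally show ?thesis .
    qed
    then have "C1 * q powr t * card P \<le> C1 * q powr t * (\<Sum>\<Delta>\<in>T S. card (P \<inter> \<Delta>))"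
      using C1_ge_1 by (intro mult_left_mono) (simp_all flip: of_nat_sum)
    ultimately show False by linarith
  qed
  then obtain \<Delta> where \<Delta>: "card P * g \<Delta> \<le> C1 * q powr t * card (P \<inter> \<Delta>)" by blast
  have "card (crossing E Q (P \<inter> \<Delta>)) \<le> card (crossing E Q \<Delta>)"
    using Q crossing_subset[of E Q \<Delta>] by (intro card_mono crossing_mono) (auto intro: finite_subset)
  then have "exp (q * card (crossing E Q (P \<inter> \<Delta>)) / card Q) \<le> g \<Delta>"
    by (simp add: g_def divide_right_mono mult_left_mono)
  then have "card P * exp (q * card (crossing E Q (P \<inter> \<Delta>)) / card Q) \<le> card P * g \<Delta>"
    by (intro mult_left_mono) auto
  then show ?thesis using \<Delta> by (intro exI[of _ "P \<inter> \<Delta>"]) auto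
qed

text \<open>
  A cell with excess \<open>x > K\<close> is refined with \<open>q' = \<lceil>x\<rceil>\<close>. Its exponential surplus of points pays
  for the factor \<open>C1 * q' powr t\<close> lost in the recursive call, so the constants do not grow.
\<close>

lemma exists_large_cell:
  fixes K :: real
  assumes K: "K \<ge> 0" "\<And>x. x > K \<Longrightarrow> C1 * \<lceil>x\<rceil> powr t < exp x"
    and P: "finite P" "P \<noteq> {}" "P \<subseteq> X"
    and Q: "finite Q" "Q \<noteq> {}" "Q \<subseteq> Y" and q: "q \<ge> (1::nat)"
  shows "\<exists>P'\<subseteq>P. card P \<le> C1 * q powr t * card P' \<and> q * card (crossing E Q P') \<le> K * card Q"
  using P Q q
proof (induction q arbitrary: P Q rule: less_induct)
  case (less q P Q)
  define n where "n = card Q"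
  have n: "n > 0" and m: "card P > 0" using less.prems by (simp_all add: n_def card_gt_0_iff)
  obtain P1 where P1: "P1 \<subseteq> P"
    and le: "card P * exp (q * card (crossing E Q P1) / n) \<le> C1 * q powr t * card P1"
    using exists_weighted_cell[OF less.prems] unfolding n_def by blast
  define R where "R = crossing E Q P1"
  define x where "x = q * card R / n"
  have le: "card P * exp x \<le> C1 * q powr t * card P1" using le by (simp add: x_def R_def)
  have x0: "x \<ge> 0" by (simp add: x_def)
  show ?case
  proof (cases "x \<le> K")
    case True
    have "real (card P) * 1 \<le> card P * exp x" using x0 by (intro mult_left_mono) auto
    moreover have "q * card R \<le> K * n" using True n by (simp add: x_def field_simps)
    ultimately show ?thesis using le P1 by (intro exI[of _ P1]) (auto simp: R_def n_def)
  next
    case False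
    define q' where "q' = nat \<lceil>x\<rceil>"
    have q': "real q' = \<lceil>x\<rceil>" "q' \<ge> 1" "x \<le> q'" using False K x0 by (auto simp: q'_def) linarith+
    have less_exp: "C1 * q' powr t < exp x" using K(2)[of x] False q' by simp
    \<comment> \<open>Since \<open>P1\<close> has at most \<open>card P\<close> points, the weight
      is at most \<open>C1 * q powr t\<close>. With \<open>less_exp\<close> this gives
      \<open>q' < q\<close>, so the recursion terminates.\<close>
    have "card P * exp x \<le> C1 * q powr t * card P"
      using le P1 less.prems C1_ge_1
      by (elim order_trans) (intro mult_left_mono; simp add: card_mono)
    then have "exp x \<le> C1 * q powr t" using m by (simp add: mult.commute)
    then have "q' powr t < q powr t" using less_exp C1_ge_1
      by (smt (verit) mult_left_mono)
    then have "q' < q" using t_ge_2 powr_mono2[of t q q'] by force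
    moreover have "P1 \<noteq> {}" using le m by (auto simp: mult_le_0_iff)
    moreover have "R \<noteq> {}" using False K by (auto simp: x_def)
    moreover have "R \<subseteq> Q" by (simp add: R_def crossing_subset)
    ultimately obtain P2 where P2: "P2 \<subseteq> P1"
      and le2: "card P1 \<le> C1 * q' powr t * card P2" and "q' * card (crossing E R P2) \<le> K * card R"
      using less.IH[of q' P1 R] P1 less.prems q'(2) by (meson finite_subset subset_trans)
    \<comment> \<open>Whatever crosses \<open>P2\<close> already crosses \<open>P1\<close>, so
      restricting the recursion to \<open>R\<close> loses nothing.\<close>
    moreover have "crossing E R P2 = crossing E Q P2"
      using crossing_mono[OF P2, of Q Q E] by (auto simp: R_def crossing_def)
    ultimately have cr: "q' * card (crossing E Q P2) \<le> K * card R" by simp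
    have "card P * exp x \<le> C1 * q powr t * (C1 * q' powr t * card P2)"
      using C1_ge_1 by (intro order_trans[OF le] mult_left_mono le2) auto
    also have "\<dots> \<le> C1 * q powr t * (exp x * card P2)"
      using C1_ge_1 less_exp by (intro mult_left_mono mult_right_mono) auto
    finally have "card P * exp x \<le> (C1 * q powr t * card P2) * exp x" by (simp add: mult_ac)
    then have 1: "card P \<le> C1 * q powr t * card P2" by simp
    \<comment> \<open>The recursive bound is relative to \<open>card R\<close>; as
      \<open>q * card R = x * n \<le> q' * n\<close>, it becomes one relative to
      \<open>n\<close>.\<close>
    have "q' * (q * card (crossing E Q P2)) \<le> q * (K * card R)"
      using mult_left_mono[OF cr, of q] by (simp add: mult_ac)
    also have "\<dots> = K * (x * n)" using n by (simp add: x_def)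
    also have "\<dots> \<le> K * (q' * n)" using K(1) q'(3) by (intro mult_left_mono) (simp_all add: mult_right_mono)
    finally have "q' * real (q * card (crossing E Q P2)) \<le> q' * (K * n)" by (simp add: mult_ac)
    then have "q * card (crossing E Q P2) \<le> K * n" using q'(2) by simp
    then show ?thesis using 1 P1 P2 by (intro exI[of _ P2]) (auto simp: n_def)
  qed
qed

section \<open>Points of low degree and the induction on \<open>card P\<close>\<close>

text \<open>
  The choice of \<open>\<rho>\<close> balances the bound: a set of \<open>\<rho>\<close> points crossed by \<open>\<rho> ^ s\<close> elements of \<open>Q\<close>
  has about \<open>\<rho> ^ s\<close> edges to them. The maximum with \<open>s\<close> makes the \<open>K\<^sub>s\<^sub>,\<^sub>u\<close> condition applicable.
\<close>

lemma exists_low_degree_vertex: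
  fixes K w \<rho> m n :: real
  assumes free: "\<not> contains_K X Y E s u" and s: "s \<ge> 1"
    and K: "K \<ge> 1" "\<And>x. x > K \<Longrightarrow> C1 * \<lceil>x\<rceil> powr t < exp x"
    and P: "finite P" "P \<noteq> {}" "P \<subseteq> X" and Q: "finite Q" "Q \<noteq> {}" "Q \<subseteq> Y"
    and m: "m = card P" and n: "n = card Q"
    and \<rho>: "\<rho> = (n powr t / m) powr (1 / (t * s - 1))" and w: "w = max \<rho> s"
    and large: "C1 * w \<le> m"
  shows "\<exists>a\<in>P. card {b \<in> Q. (a, b) \<in> E} \<le> (2 * K * C1 * s + real u * 2 ^ s) * w ^ (s - 1) + u"
proof -
  have m0: "m > 0" and n0: "n > 0" using P Q m n by (auto simp: card_gt_0_iff)
  have w1: "w \<ge> 1" and ws: "w \<ge> s" using s by (auto simp: w)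
  have "1 * 2 \<le> real s * t" using s t_ge_2 by (intro mult_mono) auto
  then have ts: "t * s - 1 > 0" by (simp add: mult.commute)
  have C1: "C1 > 0" using C1_ge_1 by simp
  \<comment> \<open>\<open>z\<close> solves \<open>C1 * z powr t = m / w\<close>, so a large cell
    for any \<open>q \<le> z\<close> has at least \<open>w\<close> points. Assumption
    \<open>large\<close> gives \<open>z \<ge> 1\<close>, and rounding down loses at most a factor
    2.\<close>
  define z where "z = (m / (C1 * w)) powr (1 / t)"
  have z1: "z \<ge> 1" using large C1 w1 t_ge_2 by (simp add: z_def ge_one_powr_ge_zero)
  have zt: "z powr t = m / (C1 * w)" using m0 C1 w1 t_ge_2 by (simp add: z_def powr_powr)
  define q where "q = nat \<lfloor>z\<rfloor>"
  have q_eq: "real q = \<lfloor>z\<rfloor>" and q1: "q \<ge> 1"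
    using z1 by (auto simp: q_def le_nat_iff)
  have q: "q \<ge> 1" "q \<le> z" "z \<le> 2 * q" using q1 q_eq by linarith+
  obtain P' where P': "P' \<subseteq> P" "m \<le> C1 * q powr t * card P'"
    and cr: "q * card (crossing E Q P') \<le> K * n"
    using exists_large_cell[of K P Q q] K P Q q m n by auto
  have "C1 * q powr t \<le> C1 * z powr t"
    using q C1 t_ge_2 by (intro mult_left_mono powr_mono2) auto
  also have "\<dots> = m / w" using zt C1 by simp
  finally have "m \<le> m / w * card P'"
    using P'(2) by (meson mult_right_mono of_nat_0_le_iff order_trans)
  then have wP': "w \<le> card P'" using m0 w1 by (simp add: field_simps)
  \<comment> \<open>\<open>P'\<close> may be far larger than \<open>w\<close>; a subset of about
    \<open>w\<close> points keeps the term \<open>u * p ^ s\<close> small and is crossed by no more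
    elements.\<close>
  define p where "p = nat \<lceil>w\<rceil>"
  have p: "p \<le> card P'" "s \<le> p" "w \<le> p" "p \<le> 2 * w"
    using wP' w1 ws by (auto simp: p_def ceiling_le_iff nat_le_iff) linarith+
  have p1: "p \<ge> 1" using p s by linarith
  obtain P'' where P'': "P'' \<subseteq> P'" "card P'' = p" "finite P''"
    using obtain_subset_with_card_n[OF p(1)] by blast
  define R where "R = crossing E Q P''"
  have R: "R \<subseteq> Q" "finite R" using Q by (auto simp: R_def crossing_def)

  \<comment> \<open>The choice of \<open>\<rho>\<close> is made for this equation. Taking
    \<open>t\<close>-th roots at the end yields \<open>n \<le> z * C1 * w ^ s\<close>, so the
    crossing bound \<open>K * n / q\<close> is of order \<open>w ^ s\<close>.\<close>
  have "n powr t = m * \<rho> powr (t * s - 1)"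
    using m0 n0 ts by (simp add: \<rho> powr_powr)
  also have "\<dots> \<le> m * w powr (t * s - 1)"
    using m0 ts w by (intro mult_left_mono powr_mono2) (auto simp: \<rho>)
  also have "\<dots> = m / (C1 * w) * (C1 powr 1 * w powr (t * s))"
    using C1 w1 by (simp add: powr_diff)
  also have "\<dots> \<le> m / (C1 * w) * (C1 powr t * w powr (t * s))"
    using C1_ge_1 t_ge_2 m0 w1 by (intro mult_left_mono mult_right_mono powr_mono) auto
  also have "\<dots> = (z * C1 * w ^ s) powr t"
    using z1 C1 w1 by (simp add: powr_mult zt powr_powr mult.commute flip: powr_realpow)
  finally have "n powr t \<le> (z * C1 * w ^ s) powr t" .
  moreover have "0 \<le> z * C1 * w ^ s" using z1 C1 w1 by simp
  ultimately have "n \<le> z * C1 * w ^ s"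
    using t_ge_2 powr_less_mono2[of t "z * C1 * w ^ s" n] by linarith
  then have "K * n \<le> K * (2 * q * C1 * w ^ s)"
    using K q C1 w1 by (intro mult_left_mono) (auto elim!: order_trans intro!: mult_right_mono)
  with cr have "q * real (card (crossing E Q P')) \<le> q * (2 * K * C1 * w ^ s)" by (simp add: mult_ac)
  then have "card (crossing E Q P') \<le> 2 * K * C1 * w ^ s" using q(1) by simp
  moreover have "card R \<le> card (crossing E Q P')"
    using P'' Q crossing_subset[of E Q P'] unfolding R_def
    by (intro card_mono crossing_mono) (auto intro: finite_subset)
  ultimately have card_R: "card R \<le> 2 * K * C1 * w ^ s" by linarith

  have w_pow: "w ^ s \<le> w ^ (s - 1) * p"
    using p w1 s by (cases s) (auto simp: mult.commute intro!: mult_right_mono)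
  have p_pow: "real p ^ s \<le> (2 ^ s * w ^ (s - 1)) * p"
  proof -
    have "real p ^ s = real p ^ (s - 1) * p" using s by (cases s) auto
    also have "\<dots> \<le> (2 * w) ^ (s - 1) * p" using p by (intro mult_right_mono power_mono) auto
    also have "\<dots> \<le> (2 ^ s * w ^ (s - 1)) * p"
      using w1 by (intro mult_right_mono) (auto simp: power_mult_distrib intro!: mult_right_mono power_increasing)
    finally show ?thesis .
  qed

  have "card (E \<inter> P'' \<times> R) \<le> s * card R + u * p ^ s"
    using Kovari_Sos_Turan_linear[OF free s, of P'' R] P'' P' P Q R by auto
  moreover have "card (E \<inter> P'' \<times> (Q - R)) \<le> p * u"
  proof -
    obtain A where A: "A \<subseteq> P''" "card A = s" "finite A"
      using obtain_subset_with_card_n[of s P''] p P'' by auto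
    \<comment> \<open>Outside \<open>R\<close>, a neighbour of one point of \<open>P''\<close> is
      adjacent to all of them, hence to the \<open>s\<close> points of \<open>A\<close>; fewer than
      \<open>u\<close> elements of \<open>Q\<close> are.\<close>
    have "E \<inter> P'' \<times> (Q - R) \<subseteq> P'' \<times> {b \<in> Q. A \<times> {b} \<subseteq> E}"
      using A by (auto simp: R_def crossing_def)
    then have "card (E \<inter> P'' \<times> (Q - R)) \<le> card (P'' \<times> {b \<in> Q. A \<times> {b} \<subseteq> E})"
      using P'' Q by (intro card_mono) auto
    also have "\<dots> = p * card {b \<in> Q. A \<times> {b} \<subseteq> E}" by (simp add: card_cartesian_product P'')
    also have "\<dots> \<le> p * u"
      using common_neighbours_less[OF free _ A(3,2) Q(1,3)] A P''(1) P'(1) P(3)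
      by (intro mult_left_mono) (auto simp: less_imp_le)
    finally show ?thesis .
  qed
  moreover have "card (E \<inter> P'' \<times> Q) = card (E \<inter> P'' \<times> R) + card (E \<inter> P'' \<times> (Q - R))"
    using P'' Q R by (subst card_Un_disjoint[symmetric]) (auto intro!: arg_cong[of _ _ card])
  ultimately have "card (E \<inter> P'' \<times> Q) \<le> s * card R + u * p ^ s + p * u" by linarith
  then have "real (card (E \<inter> P'' \<times> Q)) \<le> s * real (card R) + u * real p ^ s + p * u"
    by (simp only: of_nat_le_iff flip: of_nat_mult of_nat_power of_nat_add)
  also have "\<dots> \<le> s * (2 * K * C1 * w ^ s) + u * real p ^ s + p * u"
    using card_R by (intro add_mono mult_left_mono) auto
  also have "\<dots> \<le> s * (2 * K * C1 * (w ^ (s - 1) * p)) + u * ((2 ^ s * w ^ (s - 1)) * p) + p * u"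
    using w_pow p_pow K(1) C1 by (intro add_mono mult_left_mono) auto
  also have "\<dots> = p * ((2 * K * C1 * s + real u * 2 ^ s) * w ^ (s - 1) + u)"
    by (simp add: algebra_simps)
  finally have le: "real (card (E \<inter> P'' \<times> Q)) \<le> p * ((2 * K * C1 * s + real u * 2 ^ s) * w ^ (s - 1) + u)" .
  \<comment> \<open>The bound \<open>le\<close> is \<open>p\<close> times the target, so some point
    of \<open>P''\<close> meets it.\<close>
  show ?thesis
  proof (rule ccontr)
    assume "\<not> ?thesis"
    then have "(\<Sum>a\<in>P''. (2 * K * C1 * s + real u * 2 ^ s) * w ^ (s - 1) + u)
        < (\<Sum>a\<in>P''. real (card {b \<in> Q. (a, b) \<in> E}))"
      using P'' P' p1 by (intro sum_strict_mono) (auto simp: not_le)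
    also have "\<dots> = card (E \<inter> P'' \<times> Q)"
      using sum_neighbours_eq_card(2)[OF P''(3) Q(1)] by simp
    finally show False using le P'' by simp
  qed
qed

text \<open>When no cutting is possible, \<open>u * m ^ s\<close> in Kovari--Sos--Turan is already linear.\<close>

lemma card_power_le:
  fixes m n \<rho> :: real
  assumes s: "s \<ge> (1::nat)" and m: "m \<ge> 1" and n: "n > 0"
    and \<rho>: "\<rho> = (n powr t / m) powr (1 / (t * s - 1))"
    and small: "m < C1 * max \<rho> s"
  shows "m ^ s \<le> (C1 * s) ^ s * (m + n)"
proof (cases "\<rho> \<le> s")
  case True
  then have "m ^ s \<le> (C1 * s) ^ s * 1"
    using small m by (simp add: power_mono max_def split: if_splits)
  also have "\<dots> \<le> (C1 * s) ^ s * (m + n)"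
    using C1_ge_1 m n by (intro mult_left_mono) auto
  finally show ?thesis .
next
  case False
  have "1 * 2 \<le> real s * t" using s t_ge_2 by (intro mult_mono) auto
  then have ts: "t * s - 1 > 0" by (simp add: mult.commute)
  have C1: "C1 > 0" using C1_ge_1 by simp
  have "m powr (t * s - 1) \<le> (C1 * \<rho>) powr (t * s - 1)"
    using False small m ts by (intro powr_mono2) auto
  also have "\<dots> = C1 powr (t * s - 1) * (n powr t / m)"
    using C1 m n ts by (simp add: powr_mult \<rho> powr_powr)
  also have "\<dots> \<le> C1 powr (t * s) * (n powr t / m)"
    using C1_ge_1 m n by (intro mult_right_mono powr_mono) auto
  finally have "(m ^ s) powr t \<le> (C1 ^ s * n) powr t"
    using m n C1 by (simp add: powr_diff powr_mult powr_powr divide_le_cancel mult.commute flip: powr_realpow)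
  moreover have "0 \<le> C1 ^ s * n" using C1 n by simp
  ultimately have "m ^ s \<le> C1 ^ s * n"
    using t_ge_2 powr_less_mono2[of t "C1 ^ s * n" "m ^ s"] by linarith
  also have "\<dots> \<le> (C1 * s) ^ s * (m + n)"
    using s m n C1 by (intro mult_mono power_mono) auto
  finally show ?thesis .
qed

text \<open>\<open>A\<close> is chosen so that the low-degree point has degree at most
  \<open>A * (\<rho> ^ (s - 1) + 1)\<close>. With \<open>a\<close>, \<open>b\<close> the two
  exponents, removing it lowers the leading term by at least a quarter of
  \<open>m powr (a - 1) * n powr b\<close>, hence the factor 4. The rest of the constant serves
  point sets too small to be cut.\<close>

lemma edges_bound:
  fixes K :: real
  assumes free: "\<not> contains_K X Y E s u" and s: "s \<ge> 1"
    and K: "K \<ge> 1" "\<And>x. x > K \<Longrightarrow> C1 * \<lceil>x\<rceil> powr t < exp x"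
    and P: "finite P" "P \<subseteq> X" and Q: "finite Q" "Q \<subseteq> Y"
  defines "A \<equiv> (2 * K * C1 * s + real u * 2 ^ s) * real s ^ (s - 1) + u"
  shows "card (E \<inter> P \<times> Q) \<le> (4 * A + s + u * (C1 * s) ^ s) *
    (card P powr ((t - 1) * s / (t * s - 1)) * card Q powr (t * (real s - 1) / (t * s - 1)) +
     card P + card Q)"
  using P
proof (induction "card P" arbitrary: P)
  case 0
  then show ?case using K C1_ge_1 by (auto simp: A_def)
next
  case (Suc m' P)
  define a where "a = (t - 1) * s / (t * s - 1)"
  define b where "b = t * (real s - 1) / (t * s - 1)"
  define \<alpha> where "\<alpha> = 4 * A + s + u * (C1 * s) ^ s"
  define m where "m = real (card P)"
  define n where "n = real (card Q)"
  have "1 * 2 \<le> real s * t" using s t_ge_2 by (intro mult_mono) auto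
  then have ts: "t * s - 1 > 0" by (simp add: mult.commute)
  have C1: "C1 > 0" using C1_ge_1 by simp
  have m: "m \<ge> 1" "m = real m' + 1" using Suc.hyps(2) by (auto simp: m_def)
  have A: "A \<ge> 0" using K C1 by (auto simp: A_def)
  have \<alpha>: "\<alpha> \<ge> 4 * A" "\<alpha> \<ge> s + u * (C1 * s) ^ s" "\<alpha> \<ge> 0"
    using A C1 by (auto simp: \<alpha>_def intro!: add_nonneg_nonneg)
  \<comment> \<open>\<open>t \<ge> 2\<close> gives \<open>1 / 2 \<le> a\<close>, so the drop
    \<open>a / 2\<close> is at least \<open>1 / 4\<close>; \<open>s \<ge> 1\<close> gives
    \<open>a \<le> 1\<close>, as \<open>one_minus_powr_le\<close> demands.\<close>
  have a: "1 / 2 \<le> a" "a \<le> 1"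
  proof -
    have "2 * real s \<le> t * s" using t_ge_2 s by (intro mult_right_mono) auto
    then show "1 / 2 \<le> a" using ts by (simp add: a_def field_simps)
    show "a \<le> 1" using ts s by (simp add: a_def field_simps)
  qed
  have P: "P \<noteq> {}" using Suc.hyps by auto
  have "card (E \<inter> P \<times> Q) \<le> \<alpha> * (m powr a * n powr b + m + n)"
  proof (cases "Q = {}")
    case True
    then show ?thesis
      using \<alpha> m by (simp add: n_def)
  next
    case False
    then have n: "n > 0" using Q by (simp add: n_def card_gt_0_iff)
    define \<rho> where "\<rho> = (n powr t / m) powr (1 / (t * s - 1))"
    define w where "w = max \<rho> s"
    show ?thesis
    proof (cases "m < C1 * w")
      case True
      have "card (E \<inter> P \<times> Q) \<le> s * card Q + u * card P ^ s"
        using Kovari_Sos_Turan_linear[OF free s] Suc.prems Q by simp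
      then have "real (card (E \<inter> P \<times> Q)) \<le> s * n + u * m ^ s"
        unfolding m_def n_def by (simp only: of_nat_le_iff flip: of_nat_mult of_nat_power of_nat_add)
      also have "\<dots> \<le> s * (m + n) + u * ((C1 * s) ^ s * (m + n))"
        using card_power_le[OF s m(1) n \<rho>_def] True m unfolding w_def
        by (intro add_mono mult_left_mono) auto
      also have "\<dots> = (s + u * (C1 * s) ^ s) * (m + n)" by (simp add: algebra_simps)
      also have "\<dots> \<le> \<alpha> * (m powr a * n powr b + m + n)"
        using \<alpha> m n by (intro mult_mono) auto
      finally show ?thesis .
    next
      case large: False
      obtain v where v: "v \<in> P" and
        deg: "card {b \<in> Q. (v, b) \<in> E} \<le> (2 * K * C1 * s + real u * 2 ^ s) * w ^ (s - 1) + u"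
        using exists_low_degree_vertex[OF free s K Suc.prems(1) P Suc.prems(2) Q(1) False Q(2)
            m_def n_def \<rho>_def w_def] large by auto
      have \<rho>0: "\<rho> > 0" using m n by (simp add: \<rho>_def)
      \<comment> \<open>This is the leading term divided by \<open>m\<close>, the order by which
        that term drops when a point is removed.\<close>
      have "\<rho> ^ (s - 1) = (n powr t / m) powr (real (s - 1) / (t * s - 1))"
        using \<rho>0 m n by (simp add: \<rho>_def powr_powr flip: powr_realpow)
      also have "\<dots> = n powr b * m powr (a - 1)"
      proof -
        have "a - 1 = - (real (s - 1) / (t * s - 1))"
          using ts s by (simp add: a_def of_nat_diff field_simps)
        then show ?thesis
          using m n s by (simp add: powr_divide powr_powr b_def powr_minus_divide of_nat_diff)
      qed
      finally have \<rho>s: "\<rho> ^ (s - 1) = n powr b * m powr (a - 1)" .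
      have "w ^ (s - 1) \<le> real s ^ (s - 1) * (\<rho> ^ (s - 1) + 1)"
      proof -
        have "1 * \<rho> ^ (s - 1) \<le> real s ^ (s - 1) * \<rho> ^ (s - 1)"
          using \<rho>0 s by (intro mult_right_mono) auto
        moreover have "real s ^ (s - 1) * \<rho> ^ (s - 1) \<ge> 0" "real s ^ (s - 1) \<ge> 0"
          using \<rho>0 by auto
        moreover have "w ^ (s - 1) = \<rho> ^ (s - 1) \<or> w ^ (s - 1) = real s ^ (s - 1)"
          by (auto simp: w_def max_def)
        ultimately show ?thesis unfolding distrib_left by (smt (verit))
      qed
      then have "(2 * K * C1 * s + real u * 2 ^ s) * w ^ (s - 1) + real u * 1 \<le>
          (2 * K * C1 * s + real u * 2 ^ s) * (real s ^ (s - 1) * (\<rho> ^ (s - 1) + 1)) + u * (\<rho> ^ (s - 1) + 1)"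
        using K C1 \<rho>0 by (intro add_mono mult_left_mono) auto
      also have "\<dots> = A * (\<rho> ^ (s - 1) + 1)"
        by (simp only: A_def of_nat_power of_nat_mult of_nat_numeral distrib_right mult.assoc)
      finally have deg: "card {b \<in> Q. (v, b) \<in> E} \<le> A * (n powr b * m powr (a - 1) + 1)"
        using deg unfolding \<rho>s by linarith
      have card_Pv: "m' = card (P - {v})" using Suc.hyps(2) Suc.prems v by simp
      have IH: "card (E \<inter> (P - {v}) \<times> Q) \<le> \<alpha> * (real m' powr a * n powr b + real m' + n)"
      proof -
        have "finite (P - {v})" "P - {v} \<subseteq> X" using Suc.prems by auto
        note Suc.hyps(1)[OF card_Pv this]
        then show ?thesis
          unfolding a_def b_def \<alpha>_def n_def card_Pv .
      qed
      have "real m' powr a = m powr a * (1 - 1 / m) powr a"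
      proof -
        have "real m' = m * (1 - 1 / m)" using m by (simp add: right_diff_distrib)
        then show ?thesis by (simp only: powr_mult)
      qed
      also have "\<dots> \<le> m powr a * (1 - a * (1 / m) / 2)"
        using m a by (intro mult_left_mono one_minus_powr_le) auto
      also have "\<dots> = m powr a - a / 2 * m powr (a - 1)"
        using m(1) by (simp add: powr_diff right_diff_distrib mult.commute)
      also have "\<dots> \<le> m powr a - 1 / 4 * m powr (a - 1)"
        using a by (intro diff_left_mono mult_right_mono) auto
      finally have step: "real m' powr a \<le> m powr a - 1 / 4 * m powr (a - 1)" .
      have "\<alpha> * (real m' powr a * n powr b) \<le>
          \<alpha> * ((m powr a - 1 / 4 * m powr (a - 1)) * n powr b)"
        using \<alpha>(3) by (intro mult_left_mono mult_right_mono step) auto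
      also have "\<dots> = \<alpha> * (m powr a * n powr b) - \<alpha> / 4 * (n powr b * m powr (a - 1))"
        by (simp add: algebra_simps)
      also have "\<dots> \<le> \<alpha> * (m powr a * n powr b) - A * (n powr b * m powr (a - 1))"
        using \<alpha>(1) by (intro diff_left_mono mult_right_mono) auto
      finally have decr: "\<alpha> * (real m' powr a * n powr b) \<le>
          \<alpha> * (m powr a * n powr b) - A * (n powr b * m powr (a - 1))" .
      have "card (E \<inter> P \<times> Q) = card {b \<in> Q. (v, b) \<in> E} + card (E \<inter> (P - {v}) \<times> Q)"
        using sum_neighbours_eq_card(2)[of P Q E] sum_neighbours_eq_card(2)[of "P - {v}" Q E]
          Suc.prems Q v by (simp add: sum.remove[OF _ v])
      then have "real (card (E \<inter> P \<times> Q)) \<le>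
          A * (n powr b * m powr (a - 1) + 1) + \<alpha> * (real m' powr a * n powr b + real m' + n)"
        using deg IH by linarith
      also have "\<dots> \<le> \<alpha> * (m powr a * n powr b + m + n)"
      proof -
        \<comment> \<open>The linear term drops by \<open>\<alpha> \<ge> A\<close>, which pays for
          the constant part of the degree bound.\<close>
        have "\<alpha> * m = \<alpha> * m' + \<alpha>" by (simp add: m(2) distrib_left)
        then show ?thesis using decr \<alpha>(1) A unfolding distrib_left by linarith
      qed
      finally show ?thesis .
    qed
  qed
  then show ?case
    by (simp only: a_def b_def \<alpha>_def m_def n_def)
qed

end

section \<open>Uniform constant and transfer to distal cell decompositions\<close>

text \<open>The order of quantifiers matters: \<open>\<alpha>\<close> depends on \<open>k\<close>,
  \<open>C\<close>, \<open>t\<close>, \<open>s\<close>, \<open>u\<close> alone and serves every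
  cover and every graph, hence all instances \<open>c\<close> at once.\<close>

lemma zarankiewicz_local_cell_cover:
  fixes C t :: real
  assumes "C \<ge> 1" "t \<ge> 2" "s \<ge> 1"
  shows "\<exists>\<alpha>::real. \<forall>X Y E T P Q. local_cell_cover X Y E T k C t \<and> \<not> contains_K X Y E s u \<and>
    finite P \<and> P \<subseteq> X \<and> finite Q \<and> Q \<subseteq> Y \<longrightarrow>
    card (E \<inter> P \<times> Q) \<le> \<alpha> *
      (card P powr ((t - 1) * s / (t * s - 1)) * card Q powr (t * (real s - 1) / (t * s - 1)) +
       card P + card Q)"
proof -
  let ?C1 = "cell_const k C t"
  have "\<exists>K\<ge>1. \<forall>x>K. ?C1 * \<lceil>x\<rceil> powr t < exp x"
    using assms by (intro exists_exp_dominates) (auto simp: cell_const_def)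
  then obtain K where "K \<ge> 1 \<and> (\<forall>x>K. ?C1 * \<lceil>x\<rceil> powr t < exp x)" ..
  then have K: "K \<ge> 1" "\<And>x. x > K \<Longrightarrow> ?C1 * \<lceil>x\<rceil> powr t < exp x" by simp_all
  let ?\<alpha> = "4 * ((2 * K * ?C1 * s + real u * 2 ^ s) * real s ^ (s - 1) + u) + s + u * (?C1 * s) ^ s"
  show ?thesis
  proof (rule exI[of _ ?\<alpha>]; safe)
    fix X :: "'a set" and Y :: "'b set" and E T P Q
    assume "local_cell_cover X Y E T k C t" and free: "\<not> contains_K X Y E s u"
      and PQ: "finite P" "P \<subseteq> X" "finite Q" "Q \<subseteq> Y"
    interpret local_cell_cover X Y E T k C t by fact
    show "card (E \<inter> P \<times> Q) \<le> ?\<alpha> *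
      (card P powr ((t - 1) * s / (t * s - 1)) * card Q powr (t * (real s - 1) / (t * s - 1)) +
       card P + card Q)"
      by (rule edges_bound[OF free assms(3) K PQ])
  qed
qed

text \<open>Appending \<open>c\<close> embeds \<open>B\<close> injectively into the parameter space,
  so the cell bound carries over and \<open>k\<close>, \<open>C\<close> do not depend on
  \<open>c\<close>. Locality holds because a smaller \<open>B\<close> has fewer elements that could
  satisfy \<open>\<Theta> \<psi>\<close>.\<close>

lemma local_cell_cover_cells:
  fixes M :: "('f, 'r, 'm) fo_structure"
  assumes dcd: "distal_cell_decomposition L M nx (ny + nz) \<theta> k \<Psi> \<Theta>"
    and C: "C \<ge> 1" "\<And>B. finite B \<Longrightarrow> B \<noteq> {} \<Longrightarrow> B \<subseteq> nlists (ny + nz) (universe M) \<Longrightarrow>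
      card (cells M nx k \<Psi> \<Theta> B) \<le> C * card B powr t"
    and t: "t \<ge> 2" and c: "c \<in> nlists nz (universe M)"
  shows "local_cell_cover (nlists nx (universe M)) (nlists ny (universe M))
    (instance_rel M nx ny \<theta> c) (\<lambda>B. cells M nx k \<Psi> \<Theta> ((\<lambda>b. b @ c) ` B)) k C t"
proof
  have \<Psi>: "finite \<Psi>"
    and dec: "\<forall>B. finite B \<and> B \<noteq> {} \<and> B \<subseteq> nlists (ny + nz) (universe M) \<longrightarrow>
      \<Union> (cells M nx k \<Psi> \<Theta> B) = nlists nx (universe M) \<and>
      (\<forall>\<Delta>\<in>cells M nx k \<Psi> \<Theta> B. \<not> crossed M nx \<theta> B \<Delta>)"
    using dcd[unfolded distal_cell_decomposition_def] by (rule conjunct1, elim conjunct2[THEN conjunct2])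
  let ?Y = "nlists ny (universe M)" and ?f = "\<lambda>b. b @ c"
  have inj: "inj_on ?f B" for B by (auto simp: inj_on_def)
  have f_Y: "?f ` B \<subseteq> nlists (ny + nz) (universe M)" if "B \<subseteq> ?Y" for B
    using that c by (blast intro: nlists_appendI)
  fix B :: "'m list set"
  assume fin: "finite B"
  show "finite (cells M nx k \<Psi> \<Theta> (?f ` B))"
    by (intro finite_cells finite_imageI \<Psi> fin)
  show "\<exists>D\<subseteq>B. card D \<le> k \<and> (\<forall>B'. D \<subseteq> B' \<and> B' \<subseteq> B \<longrightarrow> \<Delta> \<in> cells M nx k \<Psi> \<Theta> (?f ` B'))"
    if \<Delta>_B: "\<Delta> \<in> cells M nx k \<Psi> \<Theta> (?f ` B)" for \<Delta>
  proof -
    obtain \<psi> bs where bs: "\<psi> \<in> \<Psi>" "set bs \<subseteq> ?f ` B" "length bs = k"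
      and \<Delta>: "\<Delta> = fibre M nx \<psi> (concat bs)"
      and noconf: "\<not> (\<exists>b\<in>?f ` B. models M (\<Theta> \<psi>) (b @ concat bs))"
      using \<Delta>_B unfolding cells_def nlists_def by blast
    \<comment> \<open>\<open>D\<close> collects the parameters of the cell; it may have fewer than
      \<open>k\<close> elements, as \<open>bs\<close> may repeat entries.\<close>
    obtain D where D: "D \<subseteq> B" "set bs = ?f ` D"
      using bs(2) by (meson subset_image_iff)
    have "card D \<le> k"
      using card_image[OF inj, of D] card_length[of bs] D(2) bs(3) by simp
    moreover have "\<Delta> \<in> cells M nx k \<Psi> \<Theta> (?f ` B')" if "D \<subseteq> B'" "B' \<subseteq> B" for B'
    proof -
      have "bs \<in> nlists k (?f ` B')"
        unfolding nlists_def using bs(3) D(2) image_mono[OF that(1), of ?f] by blast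
      moreover have "\<not> (\<exists>b\<in>?f ` B'. models M (\<Theta> \<psi>) (b @ concat bs))"
        using noconf image_mono[OF that(2), of ?f] by blast
      ultimately show ?thesis unfolding cells_def using bs(1) \<Delta> by blast
    qed
    ultimately show ?thesis using D by blast
  qed
  assume ne: "B \<noteq> {}" and sub: "B \<subseteq> ?Y"
  have B': "finite (?f ` B)" "?f ` B \<noteq> {}" "?f ` B \<subseteq> nlists (ny + nz) (universe M)"
    by (intro finite_imageI fin) (simp_all only: ne image_is_empty f_Y[OF sub] not_False_eq_True)
  have dec_B: "\<Union> (cells M nx k \<Psi> \<Theta> (?f ` B)) = nlists nx (universe M)"
    "\<forall>\<Delta>\<in>cells M nx k \<Psi> \<Theta> (?f ` B). \<not> crossed M nx \<theta> (?f ` B) \<Delta>"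
    using dec[THEN spec, THEN mp, OF conjI[OF B'(1) conjI[OF B'(2,3)]]] by (rule conjunct1, rule conjunct2)
  show "nlists nx (universe M) \<subseteq> \<Union> (cells M nx k \<Psi> \<Theta> (?f ` B))"
    by (rule equalityD2[OF dec_B(1)])
  show "card (cells M nx k \<Psi> \<Theta> (?f ` B)) \<le> C * card B powr t"
    using C(2)[OF B'] unfolding card_image[OF inj] .
  show "crossing (instance_rel M nx ny \<theta> c) B \<Delta> = {}"
    if \<Delta>: "\<Delta> \<in> cells M nx k \<Psi> \<Theta> (?f ` B)" for \<Delta>
  proof -
    have "\<not> crossed M nx \<theta> (?f ` B) \<Delta>"
      by (rule bspec[OF dec_B(2) \<Delta>])
    moreover have "\<Delta> \<subseteq> nlists nx (universe M)"
      using \<Delta> unfolding cells_def fibre_def by blast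
    moreover have "(a, b) \<in> instance_rel M nx ny \<theta> c \<longleftrightarrow> a \<in> fibre M nx \<theta> (?f b)"
      if "b \<in> B" for a b
      using sub that unfolding instance_rel_def fibre_def by blast
    ultimately show ?thesis
      unfolding crossing_def crossed_def by blast
  qed
qed (rule C(1), rule t)

theorem corollary8p8:
  fixes L :: "('f, 'r) language"
    and M :: "('f, 'r, 'm) fo_structure"
    and \<theta> :: "('f, 'r) fm"
    and nx ny nz s u :: nat
    and t :: real
  assumes "is_structure L M"
    and "t \<ge> 2"
    and "s \<ge> 1" and "u \<ge> 1"
    and "is_fm_in L (nx + ny + nz) \<theta>"
    and "has_distal_cell_decomposition_of_exponent L M nx (ny + nz) \<theta> t"
  shows "\<exists>\<alpha> :: real. \<forall>c \<in> nlists nz (universe M). \<forall>E.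
           E = instance_rel M nx ny \<theta> c \<and>
           \<not> contains_K (nlists nx (universe M)) (nlists ny (universe M)) E s u \<longrightarrow>
           (\<forall>P Q m n.
              finite P \<and> P \<subseteq> nlists nx (universe M) \<and> card P = m \<and>
              finite Q \<and> Q \<subseteq> nlists ny (universe M) \<and> card Q = n \<longrightarrow>
              real (card (E \<inter> (P \<times> Q))) \<le>
                \<alpha> * (real m powr ((t - 1) * real s / (t * real s - 1)) *
                      real n powr (t * (real s - 1) / (t * real s - 1)) +
                      real m + real n))"
proof -
  obtain k \<Psi> \<Theta> C where dcd: "distal_cell_decomposition L M nx (ny + nz) \<theta> k \<Psi> \<Theta>"
    and C: "\<forall>B. finite B \<and> B \<noteq> {} \<and> B \<subseteq> nlists (ny + nz) (universe M) \<longrightarrow>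
      card (cells M nx k \<Psi> \<Theta> B) \<le> C * card B powr t"
    using assms(6) unfolding has_distal_cell_decomposition_of_exponent_def has_exponent_def
    by (elim exE conjE)
  \<comment> \<open>\<open>has_exponent\<close> allows any real \<open>C\<close>, while the locale
    asks for \<open>C \<ge> 1\<close>.\<close>
  have C_max: "card (cells M nx k \<Psi> \<Theta> B) \<le> max C 1 * card B powr t"
    if "finite B" "B \<noteq> {}" "B \<subseteq> nlists (ny + nz) (universe M)" for B
    by (rule order_trans[OF C[rule_format]])
      (intro conjI that, intro mult_right_mono max.cobounded1 powr_ge_zero)
  have cover: "local_cell_cover (nlists nx (universe M)) (nlists ny (universe M))
    (instance_rel M nx ny \<theta> c) (\<lambda>B. cells M nx k \<Psi> \<Theta> ((\<lambda>b. b @ c) ` B)) k (max C 1) t"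
    if "c \<in> nlists nz (universe M)" for c
    by (rule local_cell_cover_cells[OF dcd max.cobounded2 C_max assms(2) that])
  obtain \<alpha> :: real where \<alpha>: "\<forall>(X :: 'm list set) (Y :: 'm list set) E T P Q.
    local_cell_cover X Y E T k (max C 1) t \<and> \<not> contains_K X Y E s u \<and>
    finite P \<and> P \<subseteq> X \<and> finite Q \<and> Q \<subseteq> Y \<longrightarrow>
    card (E \<inter> P \<times> Q) \<le> \<alpha> *
      (card P powr ((t - 1) * s / (t * s - 1)) * card Q powr (t * (real s - 1) / (t * s - 1)) +
       card P + card Q)"
    using zarankiewicz_local_cell_cover[OF max.cobounded2 assms(2,3)] by (rule exE)
  show ?thesis
  proof (rule exI[of _ \<alpha>], intro ballI allI impI, elim conjE)
    fix c E P Q m n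
    assume c: "c \<in> nlists nz (universe M)" and E: "E = instance_rel M nx ny \<theta> c"
      and free: "\<not> contains_K (nlists nx (universe M)) (nlists ny (universe M)) E s u"
      and P: "finite P" "P \<subseteq> nlists nx (universe M)" and m: "card P = m"
      and Q: "finite Q" "Q \<subseteq> nlists ny (universe M)" and n: "card Q = n"
    show "real (card (E \<inter> (P \<times> Q))) \<le>
      \<alpha> * (real m powr ((t - 1) * real s / (t * real s - 1)) *
           real n powr (t * (real s - 1) / (t * real s - 1)) + real m + real n)"
      unfolding m[symmetric] n[symmetric]
      using cover[OF c, folded E] free P Q by (intro \<alpha>[rule_format] conjI)
  qed
qed

end
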